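(* Let $(A_1,B_1),\dots,(A_k,B_k)\in\Sigma^2$ be a Streett acceptance condition. Suppose there exist a region $I\in\Sigma$ and regions $J_1,\dots,J_k\in\Sigma$ such that, for every $i=1,\dots,k$, we have $J_i\subseteq I\setminus A_i$ and $$\sup_{s\in J_i}\mathsf P_{\delta_s}(\sigma_{A_i}<\infty)<1,\qquad \inf_{s\in I}\mathsf P_{\delta_s}\big(\sigma_{B_i\cup J_i\cup I^{c}}<\infty\big)=1.$$ Then $$\mathsf P_\mu\Big(\bigcap_{i=1}^k\mathrm{Fin}(A_i)\cup\mathrm{Inf}(B_i)\Big)\ge \mathsf P_\mu(I^\omega).$$
   Context: Setting and notation. - $(S,\Sigma)$ is a measurable space. $\Omega=S^\omega$ carries the product $\sigma$-algebra $\mathcal F=\bigotimes_{i\in\omega}\Sigma$, and $\Phi_n:\Omega\to S$ is the $n$-th coordinate map. - $\mu$ is a probability measure on $(S,\Sigma)$ and $P:S\times\Sigma\to[0,1]$ is a transition probability kernel. - $\mathsf P_\mu$ is the unique probability measure on $(\Omega,\mathcal F)$ under which $(\Phi_n)$ is a time-homogeneous Markov chain with initial distribution $\mu$ and kernel $P$. That is, for all $n$ and $A_0,\dots,A_n\in\Sigma$, $$\mathsf P_\mu(\Phi_0\in A_0,\dots,\Phi_n\in A_n)=\int_{A_0}\cdots\int_{A_{n-1}}\mu(ds_0)P(s_0,ds_1)\cdots P(s_{n-1},A_n).$$ - $\mathsf P_{\delta_s}$ denotes the same measure with $\mu$ replaced by the Dirac measure at $s\in S$. Events and times. - For $A\in\Sigma$: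 $\mathrm{Fin}(A)=\bigcup_{n}\bigcap_{m\ge n}\{\Phi_m\notin A\}$ and $\mathrm{Inf}(A)=\bigcap_n\bigcup_{m\ge n}\{\Phi_m\in A\}$. - The first return time is $\sigma_A=\inf\{n\ge1:\Phi_n\in A\}$, with $\inf\emptyset=\infty$. - For $I\in\Sigma$: $I^c=S\setminus I$, and $I^\omega=\{\Phi_n\in I\text{ for all }n\ge0\}$. - A Streett acceptance condition is a finite sequence of pairs $(A_i,B_i)\in\Sigma^2$. Its reactivity property is $\bigcap_i\mathrm{Fin}(A_i)\cup\mathrm{Inf}(B_i)$. *)

theory Defs
  imports "HOL-Probability.Probability"
begin

text \<open>A measurable space is given by a measure \<open>M\<close> of which only \<open>space M\<close> and \<open>sets M\<close> matter.
  The coordinate map \<open>\<Phi>\<^sub>n\<close> is \<open>\<lambda>\<omega>. \<omega> n\<close>. A transition probability kernel is an element of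
  \<open>M \<rightarrow>\<^sub>M prob_algebra M\<close>.\<close>

abbreviation path_space :: "'s measure \<Rightarrow> (nat \<Rightarrow> 's) measure" where
  "path_space M \<equiv> PiM UNIV (\<lambda>_. M)"

text \<open>The iterated integral
  \<open>\<integral>\<^bsub>A 0\<^esub> \<dots> \<integral>\<^bsub>A (n-1)\<^esub> \<mu>(ds\<^sub>0) P(s\<^sub>0, ds\<^sub>1) \<dots> P(s\<^bsub>n-1\<^esub>, A n)\<close>, which is \<open>\<mu> (A 0)\<close> for \<open>n = 0\<close>.\<close>

primrec iterated_integral ::
    "('s \<Rightarrow> 's measure) \<Rightarrow> nat \<Rightarrow> (nat \<Rightarrow> 's set) \<Rightarrow> 's measure \<Rightarrow> ennreal" where
  "iterated_integral P 0 A \<mu> = emeasure \<mu> (A 0)"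
| "iterated_integral P (Suc n) A \<mu> =
     (\<integral>\<^sup>+s\<in>A 0. iterated_integral P n (\<lambda>i. A (Suc i)) (P s) \<partial>\<mu>)"

definition is_markov_measure ::
    "'s measure \<Rightarrow> ('s \<Rightarrow> 's measure) \<Rightarrow> 's measure \<Rightarrow> (nat \<Rightarrow> 's) measure \<Rightarrow> bool" where
  "is_markov_measure M P \<mu> Q \<longleftrightarrow>
     prob_space Q \<and> sets Q = sets (path_space M) \<and>
     (\<forall>n A. (\<forall>i\<le>n. A i \<in> sets M) \<longrightarrow>
        emeasure Q {\<omega> \<in> space (path_space M). \<forall>i\<le>n. \<omega> i \<in> A i} = iterated_integral P n A \<mu>)"

definition markov_measure ::
    "'s measure \<Rightarrow> ('s \<Rightarrow> 's measure) \<Rightarrow> 's measure \<Rightarrow> (nat \<Rightarrow> 's) measure" where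
  "markov_measure M P \<mu> = (THE Q. is_markov_measure M P \<mu> Q)"

definition Fin_visits :: "'s measure \<Rightarrow> 's set \<Rightarrow> (nat \<Rightarrow> 's) set" where
  "Fin_visits M A = (\<Union>n. \<Inter>m\<in>{n..}. {\<omega> \<in> space (path_space M). \<omega> m \<notin> A})"

definition Inf_visits :: "'s measure \<Rightarrow> 's set \<Rightarrow> (nat \<Rightarrow> 's) set" where
  "Inf_visits M A = (\<Inter>n. \<Union>m\<in>{n..}. {\<omega> \<in> space (path_space M). \<omega> m \<in> A})"

text \<open>The intersection with the whole space only matters for the empty acceptance condition.\<close>

definition reactivity :: "'s measure \<Rightarrow> nat \<Rightarrow> (nat \<Rightarrow> 's set) \<Rightarrow> (nat \<Rightarrow> 's set) \<Rightarrow> (nat \<Rightarrow> 's) set" where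
  "reactivity M k A B =
     space (path_space M) \<inter> (\<Inter>i\<in>{1..k}. Fin_visits M (A i) \<union> Inf_visits M (B i))"

text \<open>In \<open>enat\<close> the infimum of the empty set is \<open>\<infinity>\<close>.\<close>

definition return_time :: "'s set \<Rightarrow> (nat \<Rightarrow> 's) \<Rightarrow> enat" where
  "return_time A \<omega> = Inf {enat n | n. n \<ge> 1 \<and> \<omega> n \<in> A}"

definition returns :: "'s measure \<Rightarrow> 's set \<Rightarrow> (nat \<Rightarrow> 's) set" where
  "returns M A = {\<omega> \<in> space (path_space M). return_time A \<omega> < \<infinity>}"

definition stays :: "'s measure \<Rightarrow> 's set \<Rightarrow> (nat \<Rightarrow> 's) set" where
  "stays M I = {\<omega> \<in> space (path_space M). \<forall>n. \<omega> n \<in> I}"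

text \<open>The infimum of a family of probabilities, taken in the lattice \<open>[0,1]\<close>. It differs from the
  infimum in \<open>ennreal\<close> only for the empty family, where it is 1. Suprema in \<open>ennreal\<close> and in
  \<open>[0,1]\<close> agree, also for the empty family.\<close>

definition unit_INF :: "'a set \<Rightarrow> ('a \<Rightarrow> ennreal) \<Rightarrow> ennreal" where
  "unit_INF X f = inf 1 (INF x\<in>X. f x)"


text \<open>Existence (by the theorem of Ionescu-Tulcea) and uniqueness of the law of the chain.\<close>

lemma is_markov_measure_unique:
  assumes Q: "is_markov_measure M P \<mu> Q" and Q': "is_markov_measure M P \<mu> Q'"
  shows "Q = Q'"
proof (rule measure_eqI_PiM_infinite[where I = UNIV and M = "\<lambda>_. M"])
  show "sets Q = sets (path_space M)" "sets Q' = sets (path_space M)"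
    using Q Q' by (auto simp: is_markov_measure_def)
  show "finite_measure Q"
    using Q by (auto simp: is_markov_measure_def prob_space_def)
  fix A :: "nat \<Rightarrow> 'a set" and J :: "nat set"
  assume J: "finite J" and A: "\<And>i. i \<in> J \<Longrightarrow> A i \<in> sets M"
  define B where "B i = (if i \<in> J then A i else space M)" for i
  obtain n where n: "J \<subseteq> {..n}"
    using J by (meson finite_nat_iff_bounded_le)
  have B: "\<forall>i\<le>n. B i \<in> sets M"
    using A by (auto simp: B_def)
  have "prod_emb UNIV (\<lambda>_. M) J (Pi\<^sub>E J A) = {\<omega> \<in> space (path_space M). \<forall>i\<le>n. \<omega> i \<in> B i}"
    using n A[THEN sets.sets_into_space]
    by (auto simp: prod_emb_def space_PiM B_def PiE_iff subset_eq split: if_splits)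
  then show "emeasure Q (prod_emb UNIV (\<lambda>_. M) J (Pi\<^sub>E J A)) =
      emeasure Q' (prod_emb UNIV (\<lambda>_. M) J (Pi\<^sub>E J A))"
    using Q Q' B by (simp add: is_markov_measure_def)
qed

lemma is_markov_measure_exists:
  assumes P: "P \<in> M \<rightarrow>\<^sub>M prob_algebra M" and \<mu>: "prob_space \<mu>" "sets \<mu> = sets M"
  shows "\<exists>Q. is_markov_measure M P \<mu> Q"
proof -
  define K where "K n \<omega> = (case n of 0 \<Rightarrow> \<mu> | Suc m \<Rightarrow> P (\<omega> m))" for n and \<omega> :: "nat \<Rightarrow> 'a"
  have P'[measurable]: "P \<in> M \<rightarrow>\<^sub>M subprob_algebra M"
    using P by (rule measurable_prob_algebraD)
  have \<mu>': "\<mu> \<in> space (subprob_algebra M)"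
    using \<mu> by (auto simp: space_subprob_algebra prob_space_imp_subprob_space)
  interpret Ionescu_Tulcea K "\<lambda>_::nat. M"
  proof (rule Ionescu_Tulcea.intro)
    show "K i \<in> PiM {0..<i} (\<lambda>_. M) \<rightarrow>\<^sub>M subprob_algebra M" for i
      using \<mu>' by (cases i) (auto simp: K_def cong: measurable_cong)
    show "prob_space (K i x)" if "x \<in> space (PiM {0..<i} (\<lambda>_. M))" for i x
      using that \<mu> measurable_space[OF P]
      by (cases i) (auto simp: K_def space_PiM PiE_iff space_prob_algebra)
  qed
  have C1: "C k 1 \<omega> = eP k \<omega>" if "\<omega> \<in> space (PiM {0..<k} (\<lambda>_. M))" for k \<omega>
    using bind_return[OF measurable_eP that] by simp
  have upd_iff: "fun_upd \<omega> k y \<in> PiE {0..<Suc k} B \<longleftrightarrow> \<omega> \<in> PiE {0..<k} B \<and> y \<in> B k"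
    if "\<omega> \<in> space (PiM {0..<k} (\<lambda>_. M))" for \<omega> k y and B :: "nat \<Rightarrow> 'a set"
    using that by (auto simp: PiE_iff space_PiM extensional_def atLeastLessThanSuc)
  have main: "emeasure (C k (Suc m) \<omega>) (PiE {0..<k + Suc m} B) =
      indicator (PiE {0..<k} B) \<omega> * iterated_integral P m (\<lambda>i. B (k + i)) (K k \<omega>)"
    if \<omega>: "\<omega> \<in> space (PiM {0..<k} (\<lambda>_. M))" and B: "\<And>i. B i \<in> sets M" for k m \<omega> B
    using \<omega>
  proof (induction m arbitrary: k \<omega>)
    case 0
    have "emeasure (C k (Suc 0) \<omega>) (PiE {0..<k + Suc 0} B) = emeasure (eP k \<omega>) (PiE {0..<Suc k} B)"
      using C1[OF 0] by simp
    also have "\<dots> = emeasure (K k \<omega>) ((\<lambda>x. fun_upd \<omega> k x) -` PiE {0..<Suc k} B \<inter> space M)"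
      by (rule emeasure_eP[OF 0]) (auto intro!: sets_PiM_I_finite B)
    also have "(\<lambda>x. fun_upd \<omega> k x) -` PiE {0..<Suc k} B \<inter> space M =
        (if \<omega> \<in> PiE {0..<k} B then B k else {})"
      using sets.sets_into_space[OF B[of k]] upd_iff[OF 0, of _ B]
      by (cases "\<omega> \<in> PiE {0..<k} B") (simp_all add: set_eq_iff subset_eq, blast)
    finally show ?case by simp
  next
    case (Suc m)
    let ?X = "PiE {0..<k + Suc (Suc m)} B"
    have X: "?X \<in> sets (PiM {0..<Suc k + Suc m} (\<lambda>_. M))"
      by (auto intro!: sets_PiM_I_finite B)
    have upd: "fun_upd \<omega> k y \<in> space (PiM {0..<Suc k} (\<lambda>_. M))" if "y \<in> space M" for y
      using Suc.prems that by (auto simp: space_PiM PiE_iff extensional_def)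
    have "emeasure (C k (Suc (Suc m)) \<omega>) ?X = emeasure (C k 1 \<omega> \<bind> C (k + 1) (Suc m)) ?X"
      using split_C[OF Suc.prems, of 1 "Suc m"] by (simp del: C.simps)
    also have "\<dots> = emeasure (eP k \<omega> \<bind> C (Suc k) (Suc m)) ?X"
      using C1[OF Suc.prems] by (simp del: C.simps)
    also have "\<dots> = (\<integral>\<^sup>+x. emeasure (C (Suc k) (Suc m) x) ?X \<partial>eP k \<omega>)"
    proof (rule emeasure_bind[OF _ _ X])
      show "space (eP k \<omega>) \<noteq> {}"
        using prob_space_eP[OF Suc.prems] by (rule prob_space.not_empty)
      show "C (Suc k) (Suc m) \<in>
          eP k \<omega> \<rightarrow>\<^sub>M subprob_algebra (PiM {0..<Suc k + Suc m} (\<lambda>_. M))"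
        using measurable_C[of "Suc k" "Suc m"] measurable_cong_sets[OF sets_eP[OF Suc.prems] refl]
        by blast
    qed
    also have "\<dots> = (\<integral>\<^sup>+y. emeasure (C (Suc k) (Suc m) (fun_upd \<omega> k y)) ?X \<partial>K k \<omega>)"
      by (rule nn_integral_eP[OF Suc.prems],
          rule measurable_emeasure_kernel[OF measurable_C X])
    also have "\<dots> = (\<integral>\<^sup>+y. indicator (PiE {0..<k} B) \<omega> *
        (iterated_integral P m (\<lambda>i. B (k + Suc i)) (P y) * indicator (B k) y) \<partial>K k \<omega>)"
    proof (rule nn_integral_cong)
      fix y assume "y \<in> space (K k \<omega>)"
      then have y: "y \<in> space M" by (simp add: space_P[OF Suc.prems])
      have IH: "emeasure (C (Suc k) (Suc m) (fun_upd \<omega> k y)) (PiE {0..<Suc k + Suc m} B) =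
          indicator (PiE {0..<Suc k} B) (fun_upd \<omega> k y) *
          iterated_integral P m (\<lambda>i. B (Suc k + i)) (K (Suc k) (fun_upd \<omega> k y))"
        by (rule Suc.IH[OF upd[OF y]])
      have K: "K (Suc k) (fun_upd \<omega> k y) = P y" by (simp add: K_def)
      show "emeasure (C (Suc k) (Suc m) (fun_upd \<omega> k y)) ?X = indicator (PiE {0..<k} B) \<omega> *
        (iterated_integral P m (\<lambda>i. B (k + Suc i)) (P y) * indicator (B k) y)"
        using IH by (simp add: K indicator_def upd_iff[OF Suc.prems] del: C.simps)
    qed
    also have "\<dots> = indicator (PiE {0..<k} B) \<omega> *
        iterated_integral P (Suc m) (\<lambda>i. B (k + i)) (K k \<omega>)"
      by (auto simp: indicator_def)
    finally show ?case .
  qed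
  have cyl: "emeasure PF.lim {\<omega> \<in> space (path_space M). \<forall>i\<le>n. \<omega> i \<in> A i} = iterated_integral P n A \<mu>"
    if A: "\<forall>i\<le>n. A i \<in> sets M" for n A
  proof -
    define B where "B i = (if i \<le> n then A i else space M)" for i
    have B: "B i \<in> sets M" for i
      using A by (auto simp: B_def)
    have X: "PiE {0..<Suc n} B \<in> sets (PiM {0..<Suc n} (\<lambda>_. M))"
      by (intro sets_PiM_I_finite B) auto
    have sub: "PiE {0..<Suc n} B \<subseteq> space (PiM {0..<Suc n} (\<lambda>_. M))"
      using X by (rule sets.sets_into_space)
    have emb: "PF.emb {0..<Suc n} {0..<Suc n} (PiE {0..<Suc n} B) = PiE {0..<Suc n} B"
      by (rule prod_emb_id[OF sub[unfolded space_PiM]])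
    have eq: "{\<omega> \<in> space (path_space M). \<forall>i\<le>n. \<omega> i \<in> A i} = PF.emb UNIV {0..<Suc n} (PiE {0..<Suc n} B)"
      by (auto simp: prod_emb_def space_PiM PiE_iff B_def)
    have cong: "iterated_integral P n F \<nu> = iterated_integral P n G \<nu>" if "\<And>i. i \<le> n \<Longrightarrow> F i = G i" for n F G \<nu>
      using that
    proof (induction n arbitrary: F G \<nu>)
      case (Suc n)
      have "iterated_integral P n (\<lambda>i. F (Suc i)) (P s) = iterated_integral P n (\<lambda>i. G (Suc i)) (P s)" for s
        by (rule Suc.IH) (simp add: Suc.prems)
      then show ?case by (simp add: Suc.prems)
    qed simp
    have "emeasure PF.lim {\<omega> \<in> space (path_space M). \<forall>i\<le>n. \<omega> i \<in> A i} = emeasure (CI {0..<Suc n}) (PiE {0..<Suc n} B)"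
      unfolding eq by (rule lim[OF _ X]) simp
    also have "\<dots> = emeasure (C 0 (Suc n) (\<lambda>_. undefined)) (PiE {0..<Suc n} B)"
      using emeasure_CI[OF order.refl X] unfolding emb .
    also have "\<dots> = iterated_integral P n B \<mu>"
      using main[of "\<lambda>_. undefined" 0 B n] B by (simp add: K_def space_PiM del: C.simps)
    also have "\<dots> = iterated_integral P n A \<mu>"
      by (rule cong) (simp add: B_def)
    finally show ?thesis .
  qed
  have "is_markov_measure M P \<mu> PF.lim"
    unfolding is_markov_measure_def
  proof (intro conjI allI impI cyl)
    have "space PF.lim = {\<omega> \<in> space (path_space M). \<forall>i\<le>0. \<omega> i \<in> space M}"
      by (auto simp: space_PiM)
    then have "emeasure PF.lim (space PF.lim) = emeasure \<mu> (space M)"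
      using cyl[of 0 "\<lambda>_. space M"] by simp
    also have "\<dots> = 1"
      using prob_space.emeasure_space_1[OF \<mu>(1)] sets_eq_imp_space_eq[OF \<mu>(2)] by simp
    finally show "prob_space PF.lim" by (rule prob_spaceI)
  qed simp_all
  then show ?thesis ..
qed

lemma is_markov_measure_markov_measure:
  assumes "P \<in> M \<rightarrow>\<^sub>M prob_algebra M" "prob_space \<mu>" "sets \<mu> = sets M"
  shows "is_markov_measure M P \<mu> (markov_measure M P \<mu>)"
  unfolding markov_measure_def
  using is_markov_measure_exists[OF assms] is_markov_measure_unique by (metis theI)

end

theory Submission
  imports Defs
begin

text \<open>Fix one pair and let \<open>h s\<close> be the probability, started at \<open>s\<close>, of staying in \<open>I\<close>, never
  visiting \<open>B\<close>, and visiting \<open>A\<close> infinitely often. This event is closed under the shift, so on it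
  the Markov property at a return time to \<open>C\<close> bounds \<open>h\<close> by \<open>sup\<^bsub>C\<^esub> h\<close> times the return
  probability. From \<open>I\<close> the chain almost surely returns to \<open>B \<union> J \<union> I\<^sup>c\<close>, and \<open>h\<close> vanishes on
  \<open>B \<union> I\<^sup>c\<close>, so \<open>h \<le> sup\<^bsub>J\<^esub> h\<close>; a path from \<open>J\<close> must return to \<open>A\<close>, so \<open>sup\<^bsub>J\<^esub> h \<le> c sup h\<close> with
  \<open>c < 1\<close>. Hence \<open>h = 0\<close>, and the Markov property at time \<open>n\<close> gives the same for paths that avoid
  \<open>B\<close> only from time \<open>n\<close> on.\<close>

section \<open>Laws of the chain started at a point, and their dependence on that point\<close>

locale markov_kernel =
  fixes M :: "'s measure" and P :: "'s \<Rightarrow> 's measure"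
  assumes kernel: "P \<in> M \<rightarrow>\<^sub>M prob_algebra M"
begin

abbreviation K :: "'s \<Rightarrow> (nat \<Rightarrow> 's) measure" where
  "K s \<equiv> markov_measure M P (return M s)"

lemma kernel_subprob [measurable]: "P \<in> M \<rightarrow>\<^sub>M subprob_algebra M"
  using kernel by (rule measurable_prob_algebraD)

lemma prob_space_kernel: "s \<in> space M \<Longrightarrow> prob_space (P s)"
  and sets_kernel: "s \<in> space M \<Longrightarrow> sets (P s) = sets M"
  using measurable_space[OF kernel] by (auto simp: space_prob_algebra)

lemma space_kernel: "s \<in> space M \<Longrightarrow> space (P s) = space M"
  by (rule sets_eq_imp_space_eq[OF sets_kernel])

text \<open>By induction, the inner integral is a measurable function of the law \<open>P s\<close>,
  and \<open>P\<close> is itself measurable. Composed with \<open>return M\<close>, this makes the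
  cylinder probabilities of \<open>K\<close> measurable in the start.\<close>

lemma measurable_iterated_integral:
  assumes "\<And>i. i \<le> n \<Longrightarrow> A i \<in> sets M"
  shows "iterated_integral P n A \<in> borel_measurable (subprob_algebra M)"
  using assms
proof (induction n arbitrary: A)
  case 0
  then show ?case
    by (simp add: measurable_emeasure_subprob_algebra)
next
  case (Suc n)
  have [measurable]: "A 0 \<in> sets M"
    by (rule Suc.prems) simp
  have [measurable]: "iterated_integral P n (\<lambda>i. A (Suc i)) \<in> borel_measurable (subprob_algebra M)"
    by (rule Suc.IH) (simp add: Suc.prems)
  show ?case
    unfolding iterated_integral.simps
    by (rule nn_integral_measurable_subprob_algebra) measurable
qed

lemma is_markov_measure_K:
  "s \<in> space M \<Longrightarrow> is_markov_measure M P (return M s) (K s)"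
  by (rule is_markov_measure_markov_measure[OF kernel]) (auto intro: prob_space_return)

lemma prob_space_K: "s \<in> space M \<Longrightarrow> prob_space (K s)"
  and sets_K: "s \<in> space M \<Longrightarrow> sets (K s) = sets (path_space M)"
  using is_markov_measure_K by (auto simp: is_markov_measure_def)

lemma space_K: "s \<in> space M \<Longrightarrow> space (K s) = space (path_space M)"
  by (rule sets_eq_imp_space_eq[OF sets_K])

lemma emeasure_K_cylinder:
  "s \<in> space M \<Longrightarrow> (\<And>i. i \<le> n \<Longrightarrow> A i \<in> sets M) \<Longrightarrow>
    emeasure (K s) {\<omega> \<in> space (path_space M). \<forall>i\<le>n. \<omega> i \<in> A i} =
      iterated_integral P n A (return M s)"
  using is_markov_measure_K by (auto simp: is_markov_measure_def)

text \<open>Cylinders form an intersection-stable generator of the path sigma-algebra, and on them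
  \<open>K s\<close> is an iterated integral, hence measurable in \<open>s\<close>. This is what
  allows \<open>K\<close> to be bound to an initial law.\<close>

lemma measurable_K: "K \<in> M \<rightarrow>\<^sub>M prob_algebra (path_space M)"
proof (rule measurable_prob_algebra_generated[where
      \<Omega> = "space (path_space M)" and
      G = "{{\<omega> \<in> space (path_space M). \<forall>i\<le>n. \<omega> i \<in> A i} | n A. \<forall>i. A i \<in> sets M}"])
  let ?G = "{{\<omega> \<in> space (path_space M). \<forall>i\<le>n. \<omega> i \<in> A i} | n A. \<forall>i. A i \<in> sets M}"
  show "sets (path_space M) = sigma_sets (space (path_space M)) ?G"
  proof (rule antisym)
    have "{{f \<in> UNIV \<rightarrow>\<^sub>E space M. f i \<in> X} |i X. X \<in> sets M} \<subseteq> ?G"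
    proof safe
      fix i :: nat and X assume X: "X \<in> sets M"
      show "\<exists>n A. {f \<in> UNIV \<rightarrow>\<^sub>E space M. f i \<in> X} =
          {\<omega> \<in> space (path_space M). \<forall>i\<le>n. \<omega> i \<in> A i} \<and> (\<forall>i. A i \<in> sets M)"
        using X
        \<comment> \<open>A condition on coordinate \<open>i\<close> alone is a cylinder of length
          \<open>i\<close> with every other factor equal to \<open>space M\<close>.\<close>
        by (intro exI[of _ i] exI[of _ "\<lambda>j. if j = i then X else space M"])
           (auto simp: space_PiM PiE_iff)
    qed
    then show "sets (path_space M) \<subseteq> sigma_sets (space (path_space M)) ?G"
      unfolding sets_PiM_single space_PiM by (intro sigma_sets_mono') auto
  next
    have "{\<omega> \<in> space (path_space M). \<forall>i\<le>n. \<omega> i \<in> A i} \<in> sets (path_space M)"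
      if A: "\<forall>i. A i \<in> sets M" for n and A :: "nat \<Rightarrow> 's set"
    proof -
      have [measurable]: "A i \<in> sets M" for i using A by auto
      show ?thesis by measurable
    qed
    then show "sigma_sets (space (path_space M)) ?G \<subseteq> sets (path_space M)"
      by (intro sets.sigma_sets_subset) auto
  qed
  show "Int_stable ?G"
  proof (rule Int_stableI, safe)
    fix n m and A A' :: "nat \<Rightarrow> 's set"
    assume A: "\<forall>i. A i \<in> sets M" "\<forall>i. A' i \<in> sets M"
    show "\<exists>l C. {\<omega> \<in> space (path_space M). \<forall>i\<le>n. \<omega> i \<in> A i} \<inter>
        {\<omega> \<in> space (path_space M). \<forall>i\<le>m. \<omega> i \<in> A' i} =
        {\<omega> \<in> space (path_space M). \<forall>i\<le>l. \<omega> i \<in> C i} \<and> (\<forall>i. C i \<in> sets M)"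
      using A
      \<comment> \<open>The two cylinders may differ in length, so the shorter one is padded with
        \<open>space M\<close> before the factors are intersected.\<close>
      by (intro exI[of _ "max n m"]
            exI[of _ "\<lambda>i. (if i \<le> n then A i else space M) \<inter> (if i \<le> m then A' i else space M)"])
         (auto simp: space_PiM PiE_iff le_max_iff_disj)
  qed
  show "?G \<subseteq> Pow (space (path_space M))" by auto
  show "prob_space (K s)" if "s \<in> space M" for s by (rule prob_space_K[OF that])
  show "sets (K s) = sets (path_space M)" if "s \<in> space M" for s by (rule sets_K[OF that])
  fix X assume "X \<in> ?G"
  then obtain n A where X: "X = {\<omega> \<in> space (path_space M). \<forall>i\<le>n. \<omega> i \<in> A i}"
    and A: "\<And>i. A i \<in> sets M" by auto
  note measurable_iterated_integral[of n A, OF A, measurable]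
  have "(\<lambda>s. iterated_integral P n A (return M s)) \<in> borel_measurable M"
    by measurable
  then show "(\<lambda>s. emeasure (K s) X) \<in> borel_measurable M"
    by (rule measurable_cong[THEN iffD1, rotated]) (simp add: X emeasure_K_cylinder A)
qed

lemma measurable_K_subprob [measurable]: "K \<in> M \<rightarrow>\<^sub>M subprob_algebra (path_space M)"
  using measurable_K by (rule measurable_prob_algebraD)

section \<open>General initial laws as mixtures of point starts\<close>

text \<open>The initial law enters only through the outermost integral, and integrating against a
  Dirac measure evaluates that integrand at the point.\<close>

lemma nn_integral_iterated_integral_return:
  assumes \<nu>: "sets \<nu> = sets M" and A: "\<And>i. i \<le> n \<Longrightarrow> A i \<in> sets M"
  shows "(\<integral>\<^sup>+s. iterated_integral P n A (return M s) \<partial>\<nu>) = iterated_integral P n A \<nu>"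
proof (cases n)
  case 0
  with A have A0: "A 0 \<in> sets M" by auto
  have "(\<integral>\<^sup>+s. emeasure (return M s) (A 0) \<partial>\<nu>) = (\<integral>\<^sup>+s. indicator (A 0) s \<partial>\<nu>)"
    using A0 by (intro nn_integral_cong) simp
  also have "\<dots> = emeasure \<nu> (A 0)" using A0 \<nu> by simp
  finally show ?thesis using 0 by simp
next
  case (Suc m)
  have [measurable]: "A 0 \<in> sets M" by (rule A) simp
  have [measurable]: "iterated_integral P m (\<lambda>i. A (Suc i)) \<in> borel_measurable (subprob_algebra M)"
    by (rule measurable_iterated_integral) (simp add: A Suc)
  show ?thesis
    unfolding Suc iterated_integral.simps
    by (intro nn_integral_cong nn_integral_return)
       (use sets_eq_imp_space_eq[OF \<nu>] in \<open>simp, measurable\<close>)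
qed

lemma emeasure_bind_K:
  assumes "prob_space \<nu>" "sets \<nu> = sets M" "X \<in> sets (path_space M)"
  shows "emeasure (\<nu> \<bind> K) X = (\<integral>\<^sup>+s. emeasure (K s) X \<partial>\<nu>)"
proof (rule emeasure_bind[OF _ _ assms(3)])
  show "space \<nu> \<noteq> {}" using assms(1) by (rule prob_space.not_empty)
  show "K \<in> \<nu> \<rightarrow>\<^sub>M subprob_algebra (path_space M)"
    using measurable_K_subprob measurable_cong_sets[OF assms(2) refl] by blast
qed

lemma sets_bind_K:
  assumes "prob_space \<nu>" "sets \<nu> = sets M"
  shows "sets (\<nu> \<bind> K) = sets (path_space M)"
  using sets_eq_imp_space_eq[OF assms(2)]
  by (intro sets_bind prob_space.not_empty[OF assms(1)]) (simp add: sets_K)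

lemma prob_space_bind_K:
  assumes \<nu>: "prob_space \<nu>" "sets \<nu> = sets M"
  shows "prob_space (\<nu> \<bind> K)"
proof (rule prob_spaceI)
  have "emeasure (\<nu> \<bind> K) (space (path_space M)) = (\<integral>\<^sup>+s. emeasure (K s) (space (path_space M)) \<partial>\<nu>)"
    by (rule emeasure_bind_K[OF \<nu>]) simp
  also have "\<dots> = (\<integral>\<^sup>+s. 1 \<partial>\<nu>)"
    using sets_eq_imp_space_eq[OF \<nu>(2)] prob_space.emeasure_space_1[OF prob_space_K]
    by (intro nn_integral_cong) (simp add: space_K)
  also have "\<dots> = 1" using prob_space.emeasure_space_1[OF \<nu>(1)] by simp
  finally show "emeasure (\<nu> \<bind> K) (space (\<nu> \<bind> K)) = 1"
    using sets_eq_imp_space_eq[OF sets_bind_K[OF \<nu>]] by simp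
qed

lemma emeasure_bind_K_cylinder:
  assumes \<nu>: "prob_space \<nu>" "sets \<nu> = sets M" and A: "\<And>i. i \<le> n \<Longrightarrow> A i \<in> sets M"
  shows "emeasure (\<nu> \<bind> K) {\<omega> \<in> space (path_space M). \<forall>i\<le>n. \<omega> i \<in> A i} = iterated_integral P n A \<nu>"
proof -
  \<comment> \<open>Only the sets up to index \<open>n\<close> are known to be measurable.
    \<open>C\<close> agrees with \<open>A\<close> there and is measurable at every index; the
    cylinder does not see the later ones.\<close>
  define C where "C i = (if i \<le> n then A i else {})" for i
  have [measurable]: "C i \<in> sets M" for i using A by (auto simp: C_def)
  have "{\<omega> \<in> space (path_space M). \<forall>i\<le>n. \<omega> i \<in> A i} = {\<omega> \<in> space (path_space M). \<forall>i\<le>n. \<omega> i \<in> C i}"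
    by (auto simp: C_def)
  also have "\<dots> \<in> sets (path_space M)" by measurable
  finally have "emeasure (\<nu> \<bind> K) {\<omega> \<in> space (path_space M). \<forall>i\<le>n. \<omega> i \<in> A i} =
      (\<integral>\<^sup>+s. emeasure (K s) {\<omega> \<in> space (path_space M). \<forall>i\<le>n. \<omega> i \<in> A i} \<partial>\<nu>)"
    by (rule emeasure_bind_K[OF \<nu>])
  also have "\<dots> = (\<integral>\<^sup>+s. iterated_integral P n A (return M s) \<partial>\<nu>)"
    using sets_eq_imp_space_eq[OF \<nu>(2)] by (intro nn_integral_cong emeasure_K_cylinder A) auto
  finally show ?thesis using nn_integral_iterated_integral_return[OF \<nu>(2) A] by simp
qed

text \<open>Both sides have the same cylinder probabilities, and these determine the law. Null
  events under an arbitrary initial law thereby reduce to null events under every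
  \<open>K s\<close>.\<close>

lemma markov_measure_eq_bind:
  assumes \<nu>: "prob_space \<nu>" "sets \<nu> = sets M"
  shows "markov_measure M P \<nu> = \<nu> \<bind> K"
proof (rule is_markov_measure_unique)
  show "is_markov_measure M P \<nu> (markov_measure M P \<nu>)"
    by (rule is_markov_measure_markov_measure[OF kernel \<nu>])
  show "is_markov_measure M P \<nu> (\<nu> \<bind> K)"
    using prob_space_bind_K[OF \<nu>] sets_bind_K[OF \<nu>] emeasure_bind_K_cylinder[OF \<nu>]
    by (simp add: is_markov_measure_def)
qed

section \<open>First-step analysis\<close>

lemma measurable_case_nat_path:
  assumes "s \<in> space M"
  shows "case_nat s \<in> path_space M \<rightarrow>\<^sub>M path_space M"
proof (rule measurable_PiM_single')
  show "(\<lambda>\<omega>. case_nat s \<omega> i) \<in> path_space M \<rightarrow>\<^sub>M M" for i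
    using assms by (cases i) auto
  show "case_nat s \<in> space (path_space M) \<rightarrow> UNIV \<rightarrow>\<^sub>E space M"
    using assms by (auto simp: space_PiM PiE_iff split: nat.split)
qed

text \<open>The Markov property at time 1: a path from \<open>s\<close> is \<open>s\<close>
  prepended, by \<open>case_nat s\<close>, to a path with initial law \<open>P s\<close>. On
  cylinders this is the recursion of \<open>iterated_integral\<close> evaluated at a Dirac
  measure.\<close>

lemma K_eq_distr:
  assumes s: "s \<in> space M"
  shows "K s = distr (P s \<bind> K) (path_space M) (case_nat s)"
proof (rule is_markov_measure_unique[OF is_markov_measure_K[OF s]])
  note P = prob_space_kernel[OF s] sets_kernel[OF s]
  note bind = sets_bind_K[OF P] sets_eq_imp_space_eq[OF sets_bind_K[OF P]]
  interpret bind: prob_space "P s \<bind> K" by (rule prob_space_bind_K[OF P])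
  have meas: "case_nat s \<in> (P s \<bind> K) \<rightarrow>\<^sub>M path_space M"
    using measurable_case_nat_path[OF s] measurable_cong_sets[OF bind(1) refl] by blast
  show "is_markov_measure M P (return M s) (distr (P s \<bind> K) (path_space M) (case_nat s))"
    unfolding is_markov_measure_def
  proof (intro conjI allI impI)
    show "prob_space (distr (P s \<bind> K) (path_space M) (case_nat s))"
      by (rule bind.prob_space_distr[OF meas])
    fix n and A :: "nat \<Rightarrow> 's set" assume A: "\<forall>i\<le>n. A i \<in> sets M"
    define C where "C i = (if i \<le> n then A i else {})" for i
    have [measurable]: "C i \<in> sets M" for i using A by (auto simp: C_def)
    let ?X = "{\<omega> \<in> space (path_space M). \<forall>i\<le>n. \<omega> i \<in> A i}"
    have "?X = {\<omega> \<in> space (path_space M). \<forall>i\<le>n. \<omega> i \<in> C i}"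
      by (auto simp: C_def)
    also have "\<dots> \<in> sets (path_space M)" by measurable
    finally have "emeasure (distr (P s \<bind> K) (path_space M) (case_nat s)) ?X =
        emeasure (P s \<bind> K) (case_nat s -` ?X \<inter> space (path_space M))"
      unfolding bind(2)[symmetric] by (rule emeasure_distr[OF meas])
    also have "\<dots> = iterated_integral P n A (return M s)"
    \<comment> \<open>For \<open>n = 0\<close> only the prepended state is constrained, so the
      probability is 0 or 1. Otherwise the constraint splits into \<open>s\<close> lying in
      \<open>A 0\<close> and a cylinder for the rest of the path with the sets shifted by
      one.\<close>
    proof (cases n)
      case 0
      have "case_nat s -` ?X \<inter> space (path_space M) = (if s \<in> A 0 then space (path_space M) else {})"
        using measurable_space[OF measurable_case_nat_path[OF s]] 0 by auto
      then show ?thesis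
        using bind.emeasure_space_1 bind 0 A by auto
    next
      case (Suc m)
      have [measurable]: "A 0 \<in> sets M" using A by auto
      have [measurable]: "iterated_integral P m (\<lambda>i. A (Suc i)) \<in> borel_measurable (subprob_algebra M)"
        by (rule measurable_iterated_integral) (use A Suc in auto)
      have "(\<forall>i\<le>Suc m. case_nat s \<omega> i \<in> A i) \<longleftrightarrow> s \<in> A 0 \<and> (\<forall>i\<le>m. \<omega> i \<in> A (Suc i))" for \<omega>
        by (simp add: All_less_Suc2 flip: less_Suc_eq_le)
      then have "case_nat s -` ?X \<inter> space (path_space M) =
          (if s \<in> A 0 then {\<omega> \<in> space (path_space M). \<forall>i\<le>m. \<omega> i \<in> A (Suc i)} else {})"
        using measurable_space[OF measurable_case_nat_path[OF s]] Suc by auto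
      moreover have "iterated_integral P (Suc m) A (return M s) =
          iterated_integral P m (\<lambda>i. A (Suc i)) (P s) * indicator (A 0) s"
        unfolding iterated_integral.simps by (rule nn_integral_return[OF s]) measurable
      ultimately show ?thesis
        using emeasure_bind_K_cylinder[OF P, of m "\<lambda>i. A (Suc i)"] A Suc by auto
    qed
    finally show "emeasure (distr (P s \<bind> K) (path_space M) (case_nat s)) ?X =
        iterated_integral P n A (return M s)" .
  qed simp
qed

lemma sets_case_nat_vimage:
  assumes "s \<in> space M" "X \<in> sets (path_space M)"
  shows "{\<omega> \<in> space (path_space M). case_nat s \<omega> \<in> X} \<in> sets (path_space M)"
  using measurable_sets[OF measurable_case_nat_path[OF assms(1)] assms(2)]
  by (simp add: vimage_def Int_def conj_commute)

text \<open>\<open>K_eq_distr\<close> in integrated form; it drives the later inductions over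
  time.\<close>

lemma emeasure_K_step:
  assumes s: "s \<in> space M" and X: "X \<in> sets (path_space M)"
  shows "emeasure (K s) X =
    (\<integral>\<^sup>+t. emeasure (K t) {\<omega> \<in> space (path_space M). case_nat s \<omega> \<in> X} \<partial>P s)"
proof -
  note P = prob_space_kernel[OF s] sets_kernel[OF s]
  note bind = sets_bind_K[OF P] sets_eq_imp_space_eq[OF sets_bind_K[OF P]]
  have meas: "case_nat s \<in> (P s \<bind> K) \<rightarrow>\<^sub>M path_space M"
    using measurable_case_nat_path[OF s] measurable_cong_sets[OF bind(1) refl] by blast
  have "emeasure (K s) X = emeasure (P s \<bind> K) (case_nat s -` X \<inter> space (P s \<bind> K))"
    by (subst K_eq_distr[OF s]) (rule emeasure_distr[OF meas X])
  also have "case_nat s -` X \<inter> space (P s \<bind> K) = {\<omega> \<in> space (path_space M). case_nat s \<omega> \<in> X}"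
    using bind by auto
  finally show ?thesis
    using emeasure_bind_K[OF P sets_case_nat_vimage[OF s X]] by simp
qed

text \<open>Stated for one measurable \<open>C\<close> at a time because singletons need not be
  measurable. It follows from cylinders of length 0, applied to \<open>C\<close> or to its
  complement.\<close>

lemma AE_K_start:
  assumes s: "s \<in> space M" and C[measurable]: "C \<in> sets M"
  shows "AE \<omega> in K s. \<omega> 0 \<in> C \<longleftrightarrow> s \<in> C"
proof -
  have *: "AE \<omega> in K s. \<omega> 0 \<in> X" if sX: "s \<in> X" and X[measurable]: "X \<in> sets M" for X
  proof -
    interpret prob_space "K s" by (rule prob_space_K[OF s])
    have "emeasure (K s) {\<omega> \<in> space (path_space M). \<omega> 0 \<in> X} = 1"
      using emeasure_K_cylinder[OF s, of 0 "\<lambda>_. X"] sX by simp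
    moreover have "{\<omega> \<in> space (path_space M). \<omega> 0 \<in> X} \<in> sets (K s)"
      unfolding sets_K[OF s] by measurable
    ultimately have "AE \<omega> in K s. \<omega> \<in> {\<omega> \<in> space (path_space M). \<omega> 0 \<in> X}"
      by (intro AE_prob_1) (simp add: emeasure_eq_measure)
    then show ?thesis by eventually_elim simp
  qed
  show ?thesis
  proof (cases "s \<in> C")
    case True
    then show ?thesis using *[of C] by auto
  next
    case False
    then show ?thesis using *[of "space M - C"] s by auto
  qed
qed

section \<open>Returns to a set and shift-closed events\<close>

text \<open>A return time is finite exactly when its defining set is nonempty; \<open>Suc\<close>
  excludes time 0.\<close>

lemma returns_eq: "returns M C = {\<omega> \<in> space (path_space M). \<exists>n. \<omega> (Suc n) \<in> C}"
proof -
  have "return_time C \<omega> < \<infinity> \<longleftrightarrow> (\<exists>n. \<omega> (Suc n) \<in> C)" for \<omega>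
  proof -
    have "return_time C \<omega> < \<infinity> \<longleftrightarrow> (\<exists>n\<ge>1. \<omega> n \<in> C)"
      unfolding return_time_def Inf_less_iff by auto
    also have "\<dots> \<longleftrightarrow> (\<exists>n. \<omega> (Suc n) \<in> C)"
      by (metis Suc_le_D Suc_le_mono One_nat_def le0)
    finally show ?thesis .
  qed
  then show ?thesis by (simp add: returns_def)
qed

text \<open>This stands in for the strong Markov property at the return time: returns within
  \<open>n\<close> steps are treated by induction on \<open>n\<close> with first-step analysis, then
  \<open>n\<close> tends to infinity.\<close>

lemma emeasure_shift_closed_returns_le:
  assumes D: "D \<in> sets (path_space M)"
    and shift: "\<And>s \<omega>. case_nat s \<omega> \<in> D \<Longrightarrow> \<omega> \<in> space (path_space M) \<Longrightarrow> \<omega> \<in> D"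
    and C[measurable]: "C \<in> sets M"
    and le: "\<And>t. t \<in> C \<Longrightarrow> emeasure (K t) D \<le> \<eta>"
    and s: "s \<in> space M"
  shows "emeasure (K s) (D \<inter> returns M C) \<le> \<eta> * emeasure (K s) (returns M C)"
proof -
  define R where "R n = {\<omega> \<in> space (path_space M). \<exists>m<n. \<omega> (Suc m) \<in> C}" for n
  have R[measurable]: "R n \<in> sets (path_space M)" for n
    unfolding R_def by measurable
  \<comment> \<open>Time 1 of the extended path is time 0 of the remaining one, so a return at the
    first step has to be split off.\<close>
  have R_Suc: "case_nat s \<omega> \<in> R (Suc n) \<longleftrightarrow> \<omega> 0 \<in> C \<or> \<omega> \<in> R n"
    if "s \<in> space M" "\<omega> \<in> space (path_space M)" for s n \<omega>
    using that measurable_space[OF measurable_case_nat_path[OF that(1)] that(2)]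
    by (auto simp: R_def Ex_less_Suc2)
  have bounded: "emeasure (K s) (D \<inter> R n) \<le> \<eta> * emeasure (K s) (R n)" if "s \<in> space M" for n s
    using that
  proof (induction n arbitrary: s)
    case 0
    then show ?case by (simp add: R_def)
  next
    case (Suc n)
    note s = Suc.prems
    let ?V = "\<lambda>X. {\<omega> \<in> space (path_space M). case_nat s \<omega> \<in> X}"
    have V: "?V X \<in> sets (path_space M)" if "X \<in> sets (path_space M)" for X
      by (rule sets_case_nat_vimage[OF s that])
    have meas: "(\<lambda>t. emeasure (K t) (?V (R (Suc n)))) \<in> borel_measurable (P s)"
      using measurable_emeasure_kernel[OF measurable_K_subprob V[OF R]]
        measurable_cong_sets[OF sets_kernel[OF s] refl] by blast
    have "emeasure (K s) (D \<inter> R (Suc n)) = (\<integral>\<^sup>+t. emeasure (K t) (?V (D \<inter> R (Suc n))) \<partial>P s)"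
      by (rule emeasure_K_step[OF s]) (intro sets.Int D R)
    also have "\<dots> \<le> (\<integral>\<^sup>+t. \<eta> * emeasure (K t) (?V (R (Suc n))) \<partial>P s)"
    proof (rule nn_integral_mono)
      fix t assume "t \<in> space (P s)"
      then have t: "t \<in> space M" by (simp add: space_kernel[OF s])
      note start = AE_K_start[OF t C]
      show "emeasure (K t) (?V (D \<inter> R (Suc n))) \<le> \<eta> * emeasure (K t) (?V (R (Suc n)))"
      proof (cases "t \<in> C")
        case True
        have "emeasure (K t) (?V (D \<inter> R (Suc n))) \<le> emeasure (K t) D"
          by (rule emeasure_mono) (auto simp: sets_K[OF t] D intro: shift)
        also have "\<dots> \<le> \<eta> * 1" using le[OF True] by simp
        \<comment> \<open>As \<open>t\<close> lies in \<open>C\<close>, the return has already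
          happened at the first step, so its event has full probability and can replace the factor
          1.\<close>
        also have "1 = emeasure (K t) (space (K t))"
          using prob_space.emeasure_space_1[OF prob_space_K[OF t]] by simp
        also have "\<dots> = emeasure (K t) (?V (R (Suc n)))"
        proof (rule emeasure_eq_AE)
          show "AE \<omega> in K t. \<omega> \<in> space (K t) \<longleftrightarrow> \<omega> \<in> ?V (R (Suc n))"
            using start AE_space
          proof eventually_elim
            case (elim \<omega>)
            then show ?case using True R_Suc[OF s, of \<omega>] by (simp add: space_K[OF t])
          qed
        qed (simp_all add: sets_K[OF t] V R sets.top[of "K t", unfolded sets_K[OF t]])
        finally show ?thesis .
      next
        case False
        \<comment> \<open>The first step misses \<open>C\<close> almost surely, so the return must
          occur within the remaining \<open>n\<close> steps; shift closure keeps the rest of the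
          path in \<open>D\<close>.\<close>
        have "emeasure (K t) (?V (D \<inter> R (Suc n))) \<le> emeasure (K t) (D \<inter> R n)"
        proof (rule emeasure_mono_AE)
          show "AE \<omega> in K t. \<omega> \<in> ?V (D \<inter> R (Suc n)) \<longrightarrow> \<omega> \<in> D \<inter> R n"
            using start
          proof eventually_elim
            case (elim \<omega>)
            then show ?case using False R_Suc[OF s, of \<omega>] shift by auto
          qed
        qed (auto simp: sets_K[OF t] D)
        also have "\<dots> \<le> \<eta> * emeasure (K t) (R n)" by (rule Suc.IH[OF t])
        also have "\<dots> \<le> \<eta> * emeasure (K t) (?V (R (Suc n)))"
        proof (intro mult_left_mono emeasure_mono)
          show "R n \<subseteq> ?V (R (Suc n))"
            using R_Suc[OF s] by (auto simp: R_def)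
        qed (auto simp: sets_K[OF t] V)
        finally show ?thesis .
      qed
    qed
    also have "\<dots> = \<eta> * (\<integral>\<^sup>+t. emeasure (K t) (?V (R (Suc n))) \<partial>P s)"
      by (rule nn_integral_cmult[OF meas])
    also have "\<dots> = \<eta> * emeasure (K s) (R (Suc n))"
      by (simp only: emeasure_K_step[OF s R])
    finally show ?case .
  qed
  have returns: "returns M C = (\<Union>n. R n)" by (auto simp: returns_eq R_def)
  have inc: "incseq (\<lambda>n. D \<inter> R n)"
    by (auto simp: incseq_def R_def) (meson order_less_le_trans)
  have "emeasure (K s) (D \<inter> returns M C) = emeasure (K s) (\<Union>n. D \<inter> R n)"
    unfolding returns by simp
  also have "\<dots> = (SUP n. emeasure (K s) (D \<inter> R n))"
    by (rule SUP_emeasure_incseq[symmetric, OF _ inc]) (auto simp: sets_K[OF s] D)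
  also have "\<dots> \<le> \<eta> * emeasure (K s) (returns M C)"
  proof (rule SUP_least)
    fix n
    note bounded[OF s, of n]
    also have "\<eta> * emeasure (K s) (R n) \<le> \<eta> * emeasure (K s) (returns M C)"
      unfolding returns by (intro mult_left_mono emeasure_mono) (auto simp: sets_K[OF s])
    finally show "emeasure (K s) (D \<inter> R n) \<le> \<eta> * emeasure (K s) (returns M C)" .
  qed
  finally show ?thesis .
qed

section \<open>Null events for a single acceptance pair\<close>

lemma null_stay_avoid_recur:
  assumes [measurable]: "A \<in> sets M" "B \<in> sets M" "I \<in> sets M" "J \<in> sets M"
    and sup: "(SUP s\<in>J. emeasure (K s) (returns M A)) < 1"
    and ret: "\<And>s. s \<in> I \<Longrightarrow> emeasure (K s) (returns M (B \<union> J \<union> (space M - I))) \<ge> 1"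
    and s: "s \<in> space M"
  shows "emeasure (K s) {\<omega> \<in> space (path_space M).
    (\<forall>n. \<omega> n \<in> I) \<and> (\<forall>n. \<omega> n \<notin> B) \<and> (\<forall>n. \<exists>m\<ge>n. \<omega> m \<in> A)} = 0" (is "emeasure _ ?D = 0")
proof -
  define c where "c = (SUP s\<in>J. emeasure (K s) (returns M A))"
  \<comment> \<open>The supremum runs over the whole space because the states of \<open>A\<close> at
    which a path returns may lie anywhere in it.\<close>
  define H where "H = (SUP s\<in>space M. emeasure (K s) ?D)"
  define C where "C = B \<union> J \<union> (space M - I)"
  have C[measurable]: "C \<in> sets M" unfolding C_def by measurable
  have D[measurable]: "?D \<in> sets (path_space M)" by measurable
  have ret_sets[measurable]: "returns M X \<in> sets (path_space M)" if [measurable]: "X \<in> sets M" for X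
    unfolding returns_eq by measurable
  have shift: "\<omega> \<in> ?D" if "case_nat s \<omega> \<in> ?D" "\<omega> \<in> space (path_space M)" for s \<omega>
  proof -
    have "\<omega> n \<in> I \<and> \<omega> n \<notin> B \<and> (\<exists>m\<ge>n. \<omega> m \<in> A)" for n
    proof -
      have *: "case_nat s \<omega> (Suc n) \<in> I" "case_nat s \<omega> (Suc n) \<notin> B"
        "\<exists>m\<ge>Suc n. case_nat s \<omega> m \<in> A" using that(1) unfolding mem_Collect_eq by iprover+
      then obtain m where "m \<ge> Suc n" "case_nat s \<omega> m \<in> A" by iprover
      then have "\<exists>m\<ge>n. \<omega> m \<in> A" by (cases m) auto
      with * show ?thesis by simp
    qed
    then show ?thesis using that(2) by blast
  qed
  have J_le: "emeasure (K t) ?D \<le> c * H" if t: "t \<in> J" for t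
  proof -
    have tM: "t \<in> space M" using t sets.sets_into_space[OF assms(4)] by auto
    \<comment> \<open>Infinitely many visits to \<open>A\<close> include one at a positive time,
      which is a return.\<close>
    have "?D \<subseteq> ?D \<inter> returns M A"
    proof
      fix \<omega> assume \<omega>: "\<omega> \<in> ?D"
      then obtain m where "m \<ge> 1" "\<omega> m \<in> A" by blast
      then have "\<exists>n. \<omega> (Suc n) \<in> A" by (cases m) auto
      then show "\<omega> \<in> ?D \<inter> returns M A" using \<omega> by (simp add: returns_eq)
    qed
    then have "emeasure (K t) ?D \<le> emeasure (K t) (?D \<inter> returns M A)"
      by (rule emeasure_mono) (simp add: sets_K[OF tM])
    also have "\<dots> \<le> H * emeasure (K t) (returns M A)"
    proof (rule emeasure_shift_closed_returns_le[OF D shift assms(1) _ tM])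
      fix u assume "u \<in> A"
      then show "emeasure (K u) ?D \<le> H"
        unfolding H_def using sets.sets_into_space[OF assms(1)] by (intro SUP_upper) auto
    qed
    also have "\<dots> \<le> H * c"
      unfolding c_def using t by (intro mult_left_mono SUP_upper) auto
    finally show ?thesis by (simp add: mult.commute)
  qed
  have zero: "emeasure (K t) ?D = 0" if t: "t \<in> space M" "t \<in> B \<or> t \<notin> I" for t
  proof -
    have "emeasure (K t) ?D = emeasure (K t) {}"
    proof (rule emeasure_eq_AE)
      show "AE \<omega> in K t. \<omega> \<in> ?D \<longleftrightarrow> \<omega> \<in> {}"
        using AE_K_start[OF t(1) assms(2)] AE_K_start[OF t(1) assms(3)]
        by eventually_elim (use t in blast)
    qed (simp_all add: sets_K[OF t(1)])
    then show ?thesis by simp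
  qed
  have "emeasure (K t) ?D \<le> c * H" if t: "t \<in> space M" for t
  proof (cases "t \<in> I")
    case True
    interpret prob_space "K t" by (rule prob_space_K[OF t])
    have "emeasure (K t) (returns M C) = 1"
      using ret[OF True] emeasure_le_1[of "returns M C"] unfolding C_def by (intro antisym)
    then have "AE \<omega> in K t. \<omega> \<in> returns M C"
      by (intro AE_prob_1) (simp add: emeasure_eq_measure)
    then have "emeasure (K t) ?D \<le> emeasure (K t) (?D \<inter> returns M C)"
      by (intro emeasure_mono_AE) (auto simp: sets_K[OF t])
    also have "\<dots> \<le> c * H * emeasure (K t) (returns M C)"
    proof (rule emeasure_shift_closed_returns_le[OF D shift C _ t])
      fix u assume u: "u \<in> C"
      then have "u \<in> space M" using sets.sets_into_space[OF C] by auto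
      \<comment> \<open>A state of \<open>C\<close> lies in \<open>J\<close>, where
        \<open>J_le\<close> applies, or in \<open>B\<close> or outside \<open>I\<close>, where the
        probability is 0.\<close>
      then show "emeasure (K u) ?D \<le> c * H"
        using u J_le[of u] zero[of u] by (auto simp: C_def)
    qed
    also have "\<dots> \<le> c * H * 1"
      by (intro mult_left_mono emeasure_le_1) auto
    finally show ?thesis by simp
  next
    case False
    then show ?thesis using zero[OF t] by simp
  qed
  then have "H \<le> c * H" unfolding H_def by (intro SUP_least)
  \<comment> \<open>Finiteness matters: in \<open>ennreal\<close>, an infinite \<open>H\<close>
    could satisfy \<open>H \<le> c * H\<close> with \<open>0 < c < 1\<close>.\<close>
  moreover have "H \<le> 1"
    unfolding H_def by (intro SUP_least prob_space.emeasure_le_1 prob_space_K)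
  then have "H < \<top>"
    using ennreal_one_less_top by (rule order_le_less_trans)
  moreover have "c < 1" using sup by (simp add: c_def)
  ultimately have "H = 0"
    using ennreal_mult_strict_right_mono[of c 1 H]
    by (auto simp: not_less[symmetric] zero_less_iff_neq_zero)
  moreover have "emeasure (K s) ?D \<le> H" unfolding H_def using s by (intro SUP_upper)
  ultimately show ?thesis by simp
qed

text \<open>Dropping the first state lowers the time from which \<open>B\<close> is avoided by one,
  so first-step analysis gives an induction on \<open>N\<close> with the previous lemma as
  base.\<close>

lemma null_stay_eventually_avoid_recur:
  assumes [measurable]: "A \<in> sets M" "B \<in> sets M" "I \<in> sets M" "J \<in> sets M"
    and sup: "(SUP s\<in>J. emeasure (K s) (returns M A)) < 1"
    and ret: "\<And>s. s \<in> I \<Longrightarrow> emeasure (K s) (returns M (B \<union> J \<union> (space M - I))) \<ge> 1"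
    and s: "s \<in> space M"
  shows "emeasure (K s) {\<omega> \<in> space (path_space M).
    (\<forall>n. \<omega> n \<in> I) \<and> (\<forall>n\<ge>N. \<omega> n \<notin> B) \<and> (\<forall>n. \<exists>m\<ge>n. \<omega> m \<in> A)} = 0"
  using s
proof (induction N arbitrary: s)
  case 0
  then show ?case using null_stay_avoid_recur[OF assms(1-6)] by simp
next
  case (Suc N)
  let ?D = "\<lambda>N. {\<omega> \<in> space (path_space M).
    (\<forall>n. \<omega> n \<in> I) \<and> (\<forall>n\<ge>N. \<omega> n \<notin> B) \<and> (\<forall>n. \<exists>m\<ge>n. \<omega> m \<in> A)}"
  have D[measurable]: "?D N \<in> sets (path_space M)" for N by measurable
  have sub: "{\<omega> \<in> space (path_space M). case_nat s \<omega> \<in> ?D (Suc N)} \<subseteq> ?D N"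
  proof safe
    fix \<omega> :: "nat \<Rightarrow> 's" and n
    assume *: "\<forall>n. case_nat s \<omega> n \<in> I" "\<forall>n\<ge>Suc N. case_nat s \<omega> n \<notin> B"
      "\<forall>n. \<exists>m\<ge>n. case_nat s \<omega> m \<in> A"
    show "\<omega> n \<in> I" using *(1)[rule_format, of "Suc n"] by simp
    show False if "N \<le> n" "\<omega> n \<in> B" using *(2)[rule_format, of "Suc n"] that by simp
    obtain m where "m \<ge> Suc n" "case_nat s \<omega> m \<in> A" using *(3) by blast
    then show "\<exists>m\<ge>n. \<omega> m \<in> A" by (cases m) auto
  qed
  have "emeasure (K s) (?D (Suc N)) =
      (\<integral>\<^sup>+t. emeasure (K t) {\<omega> \<in> space (path_space M). case_nat s \<omega> \<in> ?D (Suc N)} \<partial>P s)"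
    by (rule emeasure_K_step[OF Suc.prems D])
  also have "\<dots> \<le> (\<integral>\<^sup>+t. emeasure (K t) (?D N) \<partial>P s)"
    using sub by (intro nn_integral_mono emeasure_mono)
      (auto simp: space_kernel[OF Suc.prems] sets_K)
  also have "\<dots> = (\<integral>\<^sup>+t. 0 \<partial>P s)"
    using Suc.IH by (intro nn_integral_cong) (simp add: space_kernel[OF Suc.prems])
  finally show ?case by simp
qed

text \<open>A path in \<open>I\<close> that violates the pair visits \<open>A\<close> infinitely
  often and avoids \<open>B\<close> from some time \<open>N\<close> on. These are countably many
  events, each null from every start and hence under the initial law.\<close>

lemma AE_stay_imp_Fin_or_Inf:
  assumes \<nu>: "prob_space \<nu>" "sets \<nu> = sets M"
    and sets[measurable]: "A \<in> sets M" "B \<in> sets M" "I \<in> sets M" "J \<in> sets M"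
    and sup: "(SUP s\<in>J. emeasure (K s) (returns M A)) < 1"
    and ret: "\<And>s. s \<in> I \<Longrightarrow> emeasure (K s) (returns M (B \<union> J \<union> (space M - I))) \<ge> 1"
  shows "AE \<omega> in markov_measure M P \<nu>. \<omega> \<in> stays M I \<longrightarrow> \<omega> \<in> Fin_visits M A \<union> Inf_visits M B"
proof -
  let ?D = "\<lambda>N. {\<omega> \<in> space (path_space M).
    (\<forall>n. \<omega> n \<in> I) \<and> (\<forall>n\<ge>N. \<omega> n \<notin> B) \<and> (\<forall>n. \<exists>m\<ge>n. \<omega> m \<in> A)}"
  note Q = markov_measure_eq_bind[OF \<nu>]
  have sets_Q: "sets (markov_measure M P \<nu>) = sets (path_space M)"
    unfolding Q by (rule sets_bind_K[OF \<nu>])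
  have D[measurable]: "?D N \<in> sets (path_space M)" for N by measurable
  have "AE \<omega> in markov_measure M P \<nu>. \<omega> \<notin> ?D N" for N
  proof (rule AE_not_in, rule null_setsI)
    have "emeasure (markov_measure M P \<nu>) (?D N) = (\<integral>\<^sup>+s. emeasure (K s) (?D N) \<partial>\<nu>)"
      unfolding Q by (rule emeasure_bind_K[OF \<nu> D])
    also have "\<dots> = (\<integral>\<^sup>+s. 0 \<partial>\<nu>)"
      using sets_eq_imp_space_eq[OF \<nu>(2)]
      by (intro nn_integral_cong null_stay_eventually_avoid_recur[OF sets sup ret]) auto
    finally show "emeasure (markov_measure M P \<nu>) (?D N) = 0" by simp
  qed (simp add: sets_Q)
  then have "AE \<omega> in markov_measure M P \<nu>. \<forall>N. \<omega> \<notin> ?D N"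
    by (intro AE_all_countable[THEN iffD2] allI)
  then show ?thesis
    by eventually_elim (auto simp: stays_def Fin_visits_def Inf_visits_def)
qed

end

section \<open>Combination of the finitely many pairs\<close>

theorem theorem3p7:
  fixes M \<mu> :: "'s measure" and P :: "'s \<Rightarrow> 's measure"
    and k :: nat and A B J :: "nat \<Rightarrow> 's set" and I :: "'s set"
  assumes "prob_space \<mu>" and "sets \<mu> = sets M"
    and "P \<in> M \<rightarrow>\<^sub>M prob_algebra M"
    and "\<And>i. i \<in> {1..k} \<Longrightarrow> A i \<in> sets M" and "\<And>i. i \<in> {1..k} \<Longrightarrow> B i \<in> sets M"
    and "I \<in> sets M" and "\<And>i. i \<in> {1..k} \<Longrightarrow> J i \<in> sets M"
    and "\<And>i. i \<in> {1..k} \<Longrightarrow> J i \<subseteq> I - A i"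
    and "\<And>i. i \<in> {1..k} \<Longrightarrow>
           (SUP s\<in>J i. emeasure (markov_measure M P (return M s)) (returns M (A i))) < 1"
    and "\<And>i. i \<in> {1..k} \<Longrightarrow>
           unit_INF I (\<lambda>s. emeasure (markov_measure M P (return M s))
             (returns M (B i \<union> J i \<union> (space M - I)))) = 1"
  shows "emeasure (markov_measure M P \<mu>) (reactivity M k A B)
           \<ge> emeasure (markov_measure M P \<mu>) (stays M I)"
proof (rule emeasure_mono_AE)
  interpret markov_kernel M P by standard (rule assms(3))
  have "AE \<omega> in markov_measure M P \<mu>.
      \<omega> \<in> stays M I \<longrightarrow> \<omega> \<in> Fin_visits M (A i) \<union> Inf_visits M (B i)" if i: "i \<in> {1..k}" for i
  proof (rule AE_stay_imp_Fin_or_Inf[OF assms(1,2) assms(4)[OF i] assms(5)[OF i] assms(6)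
        assms(7)[OF i] assms(9)[OF i]])
    fix s assume s: "s \<in> I"
    \<comment> \<open>A meet with 1 that equals 1 forces the plain infimum to be at least 1.\<close>
    have "1 \<le> (INF s\<in>I. emeasure (K s) (returns M (B i \<union> J i \<union> (space M - I))))"
      using assms(10)[OF i] unfolding unit_INF_def by (metis inf.cobounded2)
    also have "\<dots> \<le> emeasure (K s) (returns M (B i \<union> J i \<union> (space M - I)))"
      using s by (rule INF_lower)
    finally show "1 \<le> emeasure (K s) (returns M (B i \<union> J i \<union> (space M - I)))" .
  qed
  then have "AE \<omega> in markov_measure M P \<mu>. \<forall>i\<in>{1..k}.
      \<omega> \<in> stays M I \<longrightarrow> \<omega> \<in> Fin_visits M (A i) \<union> Inf_visits M (B i)"
    by (subst AE_ball_countable) (auto intro: countable_finite)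
  then show "AE \<omega> in markov_measure M P \<mu>. \<omega> \<in> stays M I \<longrightarrow> \<omega> \<in> reactivity M k A B"
    by eventually_elim (auto simp: reactivity_def stays_def)
  have "Fin_visits M (A i) \<union> Inf_visits M (B i) \<in> sets (path_space M)" if i: "i \<in> {1..k}" for i
  proof -
    note assms(4)[OF i, measurable] assms(5)[OF i, measurable]
    show ?thesis unfolding Fin_visits_def Inf_visits_def by measurable
  qed
  then have "reactivity M k A B \<in> sets (path_space M)"
    \<comment> \<open>For \<open>k = 0\<close> the intersection over the pairs is
      \<open>UNIV\<close>, and only the explicit factor \<open>space (path_space M)\<close> makes
      the event measurable.\<close>
    unfolding reactivity_def by (cases "k = 0") (auto intro!: sets.Int sets.finite_INT)
  then show "reactivity M k A B \<in> sets (markov_measure M P \<mu>)"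
    using is_markov_measure_markov_measure[OF assms(3,1,2)] by (simp add: is_markov_measure_def)
qed

end
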